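(* Let $\mathcal{T}$ be a TBox, let $\Sigma\subseteq\mathrm{sig}(\mathcal{T})$ be a signature, and let $\chi_{\mathsf q}=\langle\theta^{\mathsf q},\mathcal{A}_0^{\mathsf q},\mathcal{A}_r^{\mathsf q}\rangle$ be the module setting for $\mathcal{T}$ and $\Sigma$ defined in the context. Then $\mathcal{M}^{\chi_{\mathsf q}}\equiv^{\mathsf q}_\Sigma\mathcal{T}$, i.e. $\mathcal{M}^{\chi_{\mathsf q}}$ is $\Sigma$-query inseparable from $\mathcal{T}$: for every Boolean positive existential query $q$ over $\Sigma$ and every $\Sigma$-ABox $\mathcal{A}$, $\mathcal{M}^{\chi_{\mathsf q}}\cup\mathcal{A}\models q$ if and only if $\mathcal{T}\cup\mathcal{A}\models q$.
   Context: Rules and TBoxes. Standard first-order logic is used. A signature is a set of predicates; $\mathrm{sig}(F)$ is the signature of a set of formulas $F$; the nullary falsehood predicate $\bot$ is assumed to belong to every signature. A rule is a function-free sentence $\forall\mathbf{x}.[\varphi(\mathbf{x})\to\exists\mathbf{y}.[\bigvee_{i=1}^n\psi_i(\mathbf{x},\mathbf{y})]]$ with the body $\varphi$ and the $\psi_i$ conjunctions of distinct atoms ($n\ge 0$; for $n=0$ the head is the empty disjunction, i.e. $\bot$). Rules are safe (all universally quantified variables in the head occur in the body), and w.l.o.g. the truth symbol $\top$ does not occur in rule heads and $\bot$ does not occur in rule bodies. Universal quantifiers are usually omitted. A TBox is a finite set of rules; TBoxes mentioning equality are extended with its standard axiomatisation. A fact is a function-free ground atom; an ABox is a finite set of facts;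 a $\Sigma$-ABox is an ABox over the predicates of $\Sigma$. A positive existential query is a formula $q(\mathbf{x})=\exists\mathbf{y}.\varphi(\mathbf{x},\mathbf{y})$ with $\varphi$ built from function-free atoms using only $\wedge$ and $\vee$; it is Boolean if it has no free variables. Standing assumptions: $\mathcal{T}$ contains no constants and rules in $\mathcal{T}$ do not share existentially quantified variables. Datalog. A rule is datalog if its head has at most one atom and all variables are universally quantified; a datalog program $\mathcal{P}$ is a set of datalog rules. A fact $\gamma$ is a consequence of a datalog rule $\bigwedge_{i=1}^n\gamma_i'\to\delta$ and facts $\gamma_1,\dots,\gamma_n$ if $\gamma=\delta\sigma$ with $\sigma$ a most general unifier of $\gamma_i,\gamma_i'$ for each $1\le i\le n$. A proof of $\gamma$ in $\mathcal{P}\cup\mathcal{A}$ ($\mathcal{A}$ an ABox) is a pair $(T,\lambda)$ with $T$ a tree and $\lambda$ mapping nodes of $T$ to facts and edges of $T$ to rules of $\mathcal{P}$, such that for each node $v$: (1) $\lambda(v)=\gamma$ if $v$ is the root; (2) $\lambda(v)\in\mathcal{A}$ if $v$ is a leaf; (3) if $v$ has children $w_1,\dots,w_n$, then all edges from $v$ to the $w_i$ are labelled by the same rule $r$ and $\lambda(v)$ is a consequence of $r$ and $\lambda(w_1),\dots,\lambda(w_n)$. The support of $\gamma$ is the set of rules occurring in some proof of $\gamma$ in $\mathcal{P}\cup\mathcal{A}$. Module settings. A module setting for $\mathcal{T}$ and $\Sigma$ is a tuple $\chi=\langle\theta,\mathcal{A}_0,\mathcal{A}_r\rangle$ with $\theta$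 a substitution from the existentially quantified variables of $\mathcal{T}$ to constants, $\mathcal{A}_0$ a $\Sigma$-ABox, $\mathcal{A}_r$ a $\mathrm{sig}(\mathcal{T})$-ABox, and such that no constant in $\chi$ occurs in $\mathcal{T}$. The program $\mathcal{P}^\chi$ is the smallest datalog program containing, for each rule $\varphi(\mathbf{x})\to\exists\mathbf{y}.[\bigvee_{i=1}^n\psi_i(\mathbf{x},\mathbf{y})]$ in $\mathcal{T}$, the following corresponding datalog rules: $\varphi\to\bot$ if $n=0$, and $\varphi\to\gamma\theta$ for each $1\le i\le n$ and each atom $\gamma$ in $\psi_i$. The support of $\chi$ is the set of rules of $\mathcal{P}^\chi$ that support a fact from $\mathcal{A}_r$ in $\mathcal{P}^\chi\cup\mathcal{A}_0$. The module $\mathcal{M}^\chi$ is the set of rules in $\mathcal{T}$ that have a corresponding datalog rule in the support of $\chi$. The setting $\chi_{\mathsf q}$. Let $c_y$ (for each existentially quantified variable $y$ in $\mathcal{T}$) and $\ast$ be fresh constants. Then $\theta^{\mathsf q}=\{y\mapsto c_y\mid y\text{ existentially quantified in }\mathcal{T}\}$, $\mathcal{A}_0^{\mathsf q}=\{A(\ast,\dots,\ast)\mid A\in\Sigma\}$, and $\mathcal{A}_r^{\mathsf q}$ consists of all $\Sigma$-facts $A(a_1,\dots,a_n)$ with each $a_j$ either a constant $c_y$ or $\ast$. *)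

theory Defs
  imports Main "HOL-Library.Infinite_Typeclass"
begin

section \<open>Syntax\<close>

type_synonym var = nat

datatype 'c trm = Var var | Const 'c

text \<open>Predicates carry their arity. Equality is a predicate like any other: it has no built-in
  semantics, and its meaning comes from the rules in \<open>eq_axioms\<close> below.\<close>

datatype 'p pred = Falsum | Eq | Sym 'p nat

fun arity :: "'p pred \<Rightarrow> nat" where
  "arity Falsum = 0"
| "arity Eq = 2"
| "arity (Sym p n) = n"

datatype ('p, 'c) atom = Atom (apred: "'p pred") (aargs: "'c trm list")

abbreviation bot_atom :: "('p, 'c) atom" where
  "bot_atom \<equiv> Atom Falsum []"

fun tvars :: "'c trm \<Rightarrow> var set" where
  "tvars (Var v) = {v}"
| "tvars (Const a) = {}"

fun tconsts :: "'c trm \<Rightarrow> 'c set" where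
  "tconsts (Var v) = {}"
| "tconsts (Const a) = {a}"

definition avars :: "('p, 'c) atom \<Rightarrow> var set" where
  "avars a = (\<Union>t\<in>set (aargs a). tvars t)"

definition aconsts :: "('p, 'c) atom \<Rightarrow> 'c set" where
  "aconsts a = (\<Union>t\<in>set (aargs a). tconsts t)"

definition wf_atom :: "('p, 'c) atom \<Rightarrow> bool" where
  "wf_atom a \<longleftrightarrow> length (aargs a) = arity (apred a)"

subsection \<open>Rules and TBoxes\<close>

text \<open>\<open>Rule \<phi> ys [\<psi>\<^sub>1, \<dots>, \<psi>\<^sub>n]\<close> is the sentence
  \<open>\<forall>xs. (\<phi> \<longrightarrow> (\<exists>ys. \<psi>\<^sub>1 \<or> \<dots> \<or> \<psi>\<^sub>n))\<close>, where \<open>xs\<close> are the variables not in \<open>ys\<close>. Conjunctions are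
  lists of atoms; the empty body is the truth symbol, the empty list of disjuncts is falsehood.\<close>

datatype ('p, 'c) rule =
  Rule (body: "('p, 'c) atom list") (exvars: "var list") (heads: "('p, 'c) atom list list")

definition head_atoms :: "('p, 'c) rule \<Rightarrow> ('p, 'c) atom set" where
  "head_atoms r = (\<Union>\<psi>\<in>set (heads r). set \<psi>)"

definition rule_atoms :: "('p, 'c) rule \<Rightarrow> ('p, 'c) atom set" where
  "rule_atoms r = set (body r) \<union> head_atoms r"

definition body_vars :: "('p, 'c) rule \<Rightarrow> var set" where
  "body_vars r = (\<Union>a\<in>set (body r). avars a)"

definition safe :: "('p, 'c) rule \<Rightarrow> bool" where
  "safe r \<longleftrightarrow> (\<forall>a\<in>head_atoms r. avars a - set (exvars r) \<subseteq> body_vars r)"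

definition wf_rule :: "('p, 'c) rule \<Rightarrow> bool" where
  "wf_rule r \<longleftrightarrow>
     (\<forall>a\<in>rule_atoms r. wf_atom a) \<and>
     distinct (body r) \<and> (\<forall>\<psi>\<in>set (heads r). distinct \<psi>) \<and>
     body_vars r \<inter> set (exvars r) = {} \<and>
     safe r \<and>
     (\<forall>\<psi>\<in>set (heads r). \<psi> \<noteq> []) \<and>
     (\<forall>a\<in>set (body r). apred a \<noteq> Falsum)"

definition sig :: "('p, 'c) rule set \<Rightarrow> 'p pred set" where
  "sig T = insert Falsum (\<Union>r\<in>T. apred ` rule_atoms r)"

definition tbox_consts :: "('p, 'c) rule set \<Rightarrow> 'c set" where
  "tbox_consts T = (\<Union>r\<in>T. \<Union>a\<in>rule_atoms r. aconsts a)"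

definition tbox_exvars :: "('p, 'c) rule set \<Rightarrow> var set" where
  "tbox_exvars T = (\<Union>r\<in>T. set (exvars r))"

text \<open>Reflexivity is stated as \<open>P(x\<^sub>0,\<dots>,x\<^sub>n) \<longrightarrow> x\<^sub>i \<approx> x\<^sub>i\<close> because \<open>x \<approx> x\<close> with an empty body is
  not safe.\<close>

definition eq_refl_rule :: "'p pred \<Rightarrow> nat \<Rightarrow> ('p, 'c) rule" where
  "eq_refl_rule P i = Rule [Atom P (map Var [0..<arity P])] [] [[Atom Eq [Var i, Var i]]]"

definition eq_sym_rule :: "('p, 'c) rule" where
  "eq_sym_rule = Rule [Atom Eq [Var 0, Var 1]] [] [[Atom Eq [Var 1, Var 0]]]"

definition eq_trans_rule :: "('p, 'c) rule" where
  "eq_trans_rule =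
     Rule [Atom Eq [Var 0, Var 1], Atom Eq [Var 1, Var 2]] [] [[Atom Eq [Var 0, Var 2]]]"

definition eq_cong_rule :: "'p pred \<Rightarrow> nat \<Rightarrow> ('p, 'c) rule" where
  "eq_cong_rule P i =
     Rule [Atom P (map Var [0..<arity P]), Atom Eq [Var i, Var (arity P)]] []
          [[Atom P ((map Var [0..<arity P])[i := Var (arity P)])]]"

definition eq_axioms :: "'p pred set \<Rightarrow> ('p, 'c) rule set" where
  "eq_axioms S = {eq_sym_rule, eq_trans_rule}
     \<union> {eq_refl_rule P i | P i. P \<in> S \<and> i < arity P}
     \<union> {eq_cong_rule P i | P i. P \<in> S \<and> i < arity P}"

lemma wf_eq_axioms: "r \<in> eq_axioms S \<Longrightarrow> wf_rule r \<and> exvars r = []"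
proof -
  have 1: "P \<noteq> Falsum" if "i < arity P" for P :: "'p pred" and i
    using that by auto
  have 2: "map Var [0..<arity P] \<noteq> [Var i, Var (arity P)]" for P :: "'p pred" and i
    by (metis (no_types, lifting) atLeastLessThan_iff less_irrefl list.set_intros(1,2)
        set_map set_upt trm.inject(1) imageE)
  have 3: "tvars t \<subseteq> {0..arity P}"
    if "t \<in> set ((map Var [0..<arity P])[i := Var (arity P)])" for P :: "'p pred" and i t
    using set_update_subset_insert[of "map Var [0..<arity P]" i "Var (arity P)"] that by auto
  show "wf_rule r \<and> exvars r = []" if "r \<in> eq_axioms S"
    using that
    apply (auto simp: eq_axioms_def eq_sym_rule_def eq_trans_rule_def eq_refl_rule_def
        eq_cong_rule_def wf_rule_def rule_atoms_def head_atoms_def body_vars_def safe_def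
        wf_atom_def avars_def 2 dest: 1)
    using 3 by fastforce
qed

definition tbox :: "('p, 'c) rule set \<Rightarrow> bool" where
  "tbox T \<longleftrightarrow> finite T \<and> (\<forall>r\<in>T. wf_rule r) \<and> (Eq \<in> sig T \<longrightarrow> eq_axioms (sig T) \<subseteq> T)"

definition disjoint_exvars :: "('p, 'c) rule set \<Rightarrow> bool" where
  "disjoint_exvars T \<longleftrightarrow> (\<forall>r\<in>T. \<forall>s\<in>T. r \<noteq> s \<longrightarrow> set (exvars r) \<inter> set (exvars s) = {})"

definition signature :: "'p pred set \<Rightarrow> bool" where
  "signature S \<longleftrightarrow> Falsum \<in> S"

subsection \<open>Facts, ABoxes and queries\<close>

definition is_fact :: "('p, 'c) atom \<Rightarrow> bool" where
  "is_fact a \<longleftrightarrow> wf_atom a \<and> avars a = {}"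

definition abox :: "'p pred set \<Rightarrow> ('p, 'c) atom set \<Rightarrow> bool" where
  "abox S A \<longleftrightarrow> finite A \<and> (\<forall>a\<in>A. is_fact a \<and> apred a \<in> S)"

datatype ('p, 'c) matrix =
    MAtom "('p, 'c) atom"
  | MAnd "('p, 'c) matrix" "('p, 'c) matrix"
  | MOr "('p, 'c) matrix" "('p, 'c) matrix"

datatype ('p, 'c) peq = Exists (qvars: "var list") (qmatrix: "('p, 'c) matrix")

fun matrix_atoms :: "('p, 'c) matrix \<Rightarrow> ('p, 'c) atom set" where
  "matrix_atoms (MAtom a) = {a}"
| "matrix_atoms (MAnd m n) = matrix_atoms m \<union> matrix_atoms n"
| "matrix_atoms (MOr m n) = matrix_atoms m \<union> matrix_atoms n"

definition query_over :: "'p pred set \<Rightarrow> ('p, 'c) peq \<Rightarrow> bool" where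
  "query_over S q \<longleftrightarrow> (\<forall>a\<in>matrix_atoms (qmatrix q). wf_atom a \<and> apred a \<in> S)"

definition free_vars :: "('p, 'c) peq \<Rightarrow> var set" where
  "free_vars q = (\<Union>a\<in>matrix_atoms (qmatrix q). avars a) - set (qvars q)"

definition boolean_query :: "('p, 'c) peq \<Rightarrow> bool" where
  "boolean_query q \<longleftrightarrow> free_vars q = {}"

section \<open>First-order semantics\<close>

record ('p, 'c, 'd) interp =
  universe :: "'d set"
  const_of :: "'c \<Rightarrow> 'd"
  rel_of :: "'p pred \<Rightarrow> 'd list set"

definition interpretation_on :: "('p, 'c, 'd) interp \<Rightarrow> bool" where
  "interpretation_on I \<longleftrightarrow>
     universe I \<noteq> {} \<and> range (const_of I) \<subseteq> universe I \<and>
     (\<forall>P. rel_of I P \<subseteq> {ds. length ds = arity P \<and> set ds \<subseteq> universe I}) \<and>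
     rel_of I Falsum = {}"

definition valuation :: "('p, 'c, 'd) interp \<Rightarrow> (var \<Rightarrow> 'd) \<Rightarrow> bool" where
  "valuation I \<nu> \<longleftrightarrow> range \<nu> \<subseteq> universe I"

fun eval :: "('p, 'c, 'd) interp \<Rightarrow> (var \<Rightarrow> 'd) \<Rightarrow> 'c trm \<Rightarrow> 'd" where
  "eval I \<nu> (Var v) = \<nu> v"
| "eval I \<nu> (Const a) = const_of I a"

definition sat_atom :: "('p, 'c, 'd) interp \<Rightarrow> (var \<Rightarrow> 'd) \<Rightarrow> ('p, 'c) atom \<Rightarrow> bool" where
  "sat_atom I \<nu> a \<longleftrightarrow> map (eval I \<nu>) (aargs a) \<in> rel_of I (apred a)"

definition variant_on :: "var list \<Rightarrow> (var \<Rightarrow> 'd) \<Rightarrow> (var \<Rightarrow> 'd) \<Rightarrow> bool" where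
  "variant_on ys \<nu> \<mu> \<longleftrightarrow> (\<forall>v. v \<notin> set ys \<longrightarrow> \<mu> v = \<nu> v)"

definition sat_rule :: "('p, 'c, 'd) interp \<Rightarrow> ('p, 'c) rule \<Rightarrow> bool" where
  "sat_rule I r \<longleftrightarrow>
     (\<forall>\<nu>. valuation I \<nu> \<longrightarrow> (\<forall>a\<in>set (body r). sat_atom I \<nu> a) \<longrightarrow>
        (\<exists>\<mu>. valuation I \<mu> \<and> variant_on (exvars r) \<nu> \<mu> \<and>
             (\<exists>\<psi>\<in>set (heads r). \<forall>a\<in>set \<psi>. sat_atom I \<mu> a)))"

definition sat_fact :: "('p, 'c, 'd) interp \<Rightarrow> ('p, 'c) atom \<Rightarrow> bool" where
  "sat_fact I a \<longleftrightarrow> (\<forall>\<nu>. valuation I \<nu> \<longrightarrow> sat_atom I \<nu> a)"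

fun sat_matrix :: "('p, 'c, 'd) interp \<Rightarrow> (var \<Rightarrow> 'd) \<Rightarrow> ('p, 'c) matrix \<Rightarrow> bool" where
  "sat_matrix I \<nu> (MAtom a) \<longleftrightarrow> sat_atom I \<nu> a"
| "sat_matrix I \<nu> (MAnd m n) \<longleftrightarrow> sat_matrix I \<nu> m \<and> sat_matrix I \<nu> n"
| "sat_matrix I \<nu> (MOr m n) \<longleftrightarrow> sat_matrix I \<nu> m \<or> sat_matrix I \<nu> n"

definition sat_query :: "('p, 'c, 'd) interp \<Rightarrow> ('p, 'c) peq \<Rightarrow> bool" where
  "sat_query I q \<longleftrightarrow>
     (\<forall>\<nu>. valuation I \<nu> \<longrightarrow>
        (\<exists>\<mu>. valuation I \<mu> \<and> variant_on (qvars q) \<nu> \<mu> \<and> sat_matrix I \<mu> (qmatrix q)))"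

text \<open>The type argument only supplies the elements from which universes are formed: every nonempty
  subset of \<open>'d\<close> is an admissible universe. Finite types are
  of no use, since they bound the size of universes; over an infinite \<open>'d\<close> no countermodel is lost,
  because (downward Loewenheim-Skolem) there is a countable one if there is any, and that has an
  isomorphic copy with universe in \<open>'d\<close>.\<close>

definition entails ::
  "'d itself \<Rightarrow> ('p, 'c) rule set \<Rightarrow> ('p, 'c) atom set \<Rightarrow> ('p, 'c) peq \<Rightarrow> bool" where
  "entails D T A q \<longleftrightarrow>
     (\<forall>I :: ('p, 'c, 'd) interp. interpretation_on I \<longrightarrow>
        (\<forall>r\<in>T. sat_rule I r) \<longrightarrow> (\<forall>a\<in>A. sat_fact I a) \<longrightarrow> sat_query I q)"

definition query_inseparable ::
  "'d itself \<Rightarrow> 'p pred set \<Rightarrow> ('p, 'c) rule set \<Rightarrow> ('p, 'c) rule set \<Rightarrow> bool" where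
  "query_inseparable D S T\<^sub>1 T\<^sub>2 \<longleftrightarrow>
     (\<forall>q A. boolean_query q \<longrightarrow> query_over S q \<longrightarrow> abox S A \<longrightarrow>
        (entails D T\<^sub>1 A q \<longleftrightarrow> entails D T\<^sub>2 A q))"

section \<open>Datalog\<close>

text \<open>A rule with empty head is represented with head \<open>bot_atom\<close>.\<close>

datatype ('p, 'c) dlrule = DL (dlbody: "('p, 'c) atom list") (dlhead: "('p, 'c) atom")

fun subst_trm :: "(var \<Rightarrow> 'c trm) \<Rightarrow> 'c trm \<Rightarrow> 'c trm" where
  "subst_trm \<sigma> (Var v) = \<sigma> v"
| "subst_trm \<sigma> (Const a) = Const a"

definition subst_atom :: "(var \<Rightarrow> 'c trm) \<Rightarrow> ('p, 'c) atom \<Rightarrow> ('p, 'c) atom" where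
  "subst_atom \<sigma> a = Atom (apred a) (map (subst_trm \<sigma>) (aargs a))"

definition unifies :: "(var \<Rightarrow> 'c trm) \<Rightarrow> ('p, 'c) atom list \<Rightarrow> ('p, 'c) atom list \<Rightarrow> bool" where
  "unifies \<sigma> as bs \<longleftrightarrow> map (subst_atom \<sigma>) as = map (subst_atom \<sigma>) bs"

definition is_mgu :: "(var \<Rightarrow> 'c trm) \<Rightarrow> ('p, 'c) atom list \<Rightarrow> ('p, 'c) atom list \<Rightarrow> bool" where
  "is_mgu \<sigma> as bs \<longleftrightarrow>
     unifies \<sigma> as bs \<and>
     (\<forall>\<tau>. unifies \<tau> as bs \<longrightarrow> (\<exists>\<rho>. \<forall>v. \<tau> v = subst_trm \<rho> (\<sigma> v)))"

definition consequence ::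
  "('p, 'c) dlrule \<Rightarrow> ('p, 'c) atom list \<Rightarrow> ('p, 'c) atom \<Rightarrow> bool" where
  "consequence r facts \<gamma> \<longleftrightarrow>
     is_fact \<gamma> \<and> (\<exists>\<sigma>. is_mgu \<sigma> facts (dlbody r) \<and> \<gamma> = subst_atom \<sigma> (dlhead r))"

text \<open>Proof trees. All edges from a node to its children carry the same rule, which is therefore
  stored at the parent. A \<open>Step\<close> without children applies a rule whose body is empty.\<close>

datatype ('p, 'c) ptree =
    Leaf "('p, 'c) atom"
  | Step "('p, 'c) atom" "('p, 'c) dlrule" "('p, 'c) ptree list"

fun root :: "('p, 'c) ptree \<Rightarrow> ('p, 'c) atom" where
  "root (Leaf \<gamma>) = \<gamma>"
| "root (Step \<gamma> r ts) = \<gamma>"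

fun valid_tree :: "('p, 'c) dlrule set \<Rightarrow> ('p, 'c) atom set \<Rightarrow> ('p, 'c) ptree \<Rightarrow> bool" where
  "valid_tree P A (Leaf \<gamma>) \<longleftrightarrow> \<gamma> \<in> A"
| "valid_tree P A (Step \<gamma> r ts) \<longleftrightarrow>
     r \<in> P \<and> consequence r (map root ts) \<gamma> \<and> (\<forall>t\<in>set ts. valid_tree P A t)"

fun tree_rules :: "('p, 'c) ptree \<Rightarrow> ('p, 'c) dlrule set" where
  "tree_rules (Leaf \<gamma>) = {}"
| "tree_rules (Step \<gamma> r ts) = insert r (\<Union>t\<in>set ts. tree_rules t)"

definition proof_of ::
  "('p, 'c) dlrule set \<Rightarrow> ('p, 'c) atom set \<Rightarrow> ('p, 'c) atom \<Rightarrow> ('p, 'c) ptree \<Rightarrow> bool" where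
  "proof_of P A \<gamma> t \<longleftrightarrow> valid_tree P A t \<and> root t = \<gamma>"

definition fact_support ::
  "('p, 'c) dlrule set \<Rightarrow> ('p, 'c) atom set \<Rightarrow> ('p, 'c) atom \<Rightarrow> ('p, 'c) dlrule set" where
  "fact_support P A \<gamma> = (\<Union>t\<in>{t. proof_of P A \<gamma> t}. tree_rules t)"

section \<open>Module settings\<close>

text \<open>Only the values of \<open>theta\<close> on the existentially quantified variables of the TBox matter.\<close>

record ('p, 'c) setting =
  theta :: "var \<Rightarrow> 'c"
  facts0 :: "('p, 'c) atom set"
  factsr :: "('p, 'c) atom set"

definition setting_consts :: "('p, 'c) rule set \<Rightarrow> ('p, 'c) setting \<Rightarrow> 'c set" where
  "setting_consts T \<chi> =
     theta \<chi> ` tbox_exvars T \<union> (\<Union>a\<in>facts0 \<chi> \<union> factsr \<chi>. aconsts a)"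

definition module_setting ::
  "('p, 'c) rule set \<Rightarrow> 'p pred set \<Rightarrow> ('p, 'c) setting \<Rightarrow> bool" where
  "module_setting T S \<chi> \<longleftrightarrow>
     abox S (facts0 \<chi>) \<and> abox (sig T) (factsr \<chi>) \<and> setting_consts T \<chi> \<inter> tbox_consts T = {}"

text \<open>The substitution acts on the existentially quantified variables of the rule at hand only, so
  that a universally quantified variable is left alone even if its name is quantified
  existentially in another rule.\<close>

definition ex_subst :: "(var \<Rightarrow> 'c) \<Rightarrow> ('p, 'c) rule \<Rightarrow> var \<Rightarrow> 'c trm" where
  "ex_subst \<theta> r v = (if v \<in> set (exvars r) then Const (\<theta> v) else Var v)"

definition corresponding :: "(var \<Rightarrow> 'c) \<Rightarrow> ('p, 'c) rule \<Rightarrow> ('p, 'c) dlrule set" where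
  "corresponding \<theta> r =
     (if heads r = [] then {DL (body r) bot_atom}
      else {DL (body r) (subst_atom (ex_subst \<theta> r) \<gamma>) | \<gamma>. \<gamma> \<in> head_atoms r})"

definition program :: "('p, 'c) rule set \<Rightarrow> ('p, 'c) setting \<Rightarrow> ('p, 'c) dlrule set" where
  "program T \<chi> = (\<Union>r\<in>T. corresponding (theta \<chi>) r)"

definition setting_support :: "('p, 'c) rule set \<Rightarrow> ('p, 'c) setting \<Rightarrow> ('p, 'c) dlrule set" where
  "setting_support T \<chi> = (\<Union>\<gamma>\<in>factsr \<chi>. fact_support (program T \<chi>) (facts0 \<chi>) \<gamma>)"

definition module_of :: "('p, 'c) rule set \<Rightarrow> ('p, 'c) setting \<Rightarrow> ('p, 'c) rule set" where
  "module_of T \<chi> = {r \<in> T. corresponding (theta \<chi>) r \<inter> setting_support T \<chi> \<noteq> {}}"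

subsection \<open>The setting for query inseparability\<close>

definition fresh_constants :: "('p, 'c) rule set \<Rightarrow> (var \<Rightarrow> 'c) \<Rightarrow> 'c \<Rightarrow> bool" where
  "fresh_constants T c star \<longleftrightarrow>
     inj_on c (tbox_exvars T) \<and> star \<notin> c ` tbox_exvars T \<and>
     insert star (c ` tbox_exvars T) \<inter> tbox_consts T = {}"

definition chi_q ::
  "('p, 'c) rule set \<Rightarrow> 'p pred set \<Rightarrow> (var \<Rightarrow> 'c) \<Rightarrow> 'c \<Rightarrow> ('p, 'c) setting" where
  "chi_q T S c star =
     \<lparr> theta = c,
       facts0 = {Atom P (replicate (arity P) (Const star)) | P. P \<in> S},
       factsr = {Atom P (map Const as) | P as.
                   P \<in> S \<and> length as = arity P \<and> set as \<subseteq> insert star (c ` tbox_exvars T)} \<rparr>"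

lemma finite_sig: "tbox T \<Longrightarrow> finite (sig T)"
  unfolding tbox_def sig_def rule_atoms_def head_atoms_def by auto

lemma module_setting_chi_q:
  assumes "tbox T" "S \<subseteq> sig T" "fresh_constants T c star"
  shows "module_setting T S (chi_q T S c star)"
proof -
  let ?K = "insert star (c ` tbox_exvars T)"
  have fS: "finite S"
    using assms(1,2) finite_sig finite_subset by blast
  have fK: "finite ?K"
    using assms(1) by (auto simp: tbox_def tbox_exvars_def)
  have "finite (\<Union>P\<in>S. Atom P ` (map Const ` {as. set as \<subseteq> ?K \<and> length as = arity P}))"
    using fS finite_lists_length_eq[OF fK] by blast
  moreover have "factsr (chi_q T S c star) \<subseteq>
      (\<Union>P\<in>S. Atom P ` (map Const ` {as. set as \<subseteq> ?K \<and> length as = arity P}))"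
    by (auto simp: chi_q_def)
  ultimately have f: "finite (factsr (chi_q T S c star))"
    using finite_subset by blast
  have "setting_consts T (chi_q T S c star) \<subseteq> ?K"
    by (fastforce simp: setting_consts_def chi_q_def aconsts_def)
  then have "setting_consts T (chi_q T S c star) \<inter> tbox_consts T = {}"
    using assms(3) unfolding fresh_constants_def by blast
  then show ?thesis
    unfolding module_setting_def using assms(2) fS f
    by (auto simp: abox_def is_fact_def wf_atom_def
        avars_def chi_q_def)
qed

end

theory Submission
  imports Defs
begin

text \<open>Let \<open>I\<close> be a countermodel of \<open>q\<close> for the module and an ABox. Give every element of \<open>I\<close> one copy
  for each constant of the setting, and interpret constants by copies labelled \<open>\<ast>\<close>. A tuple of
  copies belongs to a relation iff the fact formed by its labels is derivable in the datalog program
  and, in case the fact is relevant (all rules supporting it support \<open>\<chi>\<close>), the underlying tuple belongs to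
  the relation in \<open>I\<close>. Relevant facts are only derived from relevant ones and by rules of the module,
  so rules with a relevant head instance hold because they hold in \<open>I\<close>, and all other rules hold
  because derivable irrelevant facts are unconditionally true. All derivable facts over \<open>\<Sigma>\<close> are
  relevant, so the projection to \<open>I\<close> preserves \<open>q\<close>.\<close>

section \<open>Derivability and ground instances\<close>

definition derivable :: "('p, 'c) dlrule set \<Rightarrow> ('p, 'c) atom set \<Rightarrow> ('p, 'c) atom \<Rightarrow> bool" where
  "derivable P A \<gamma> \<longleftrightarrow> (\<exists>t. proof_of P A \<gamma> t)"

text \<open>The assignment is total on variables, so every instance is ground; below,
  \<open>\<kappa>\<close> is the labelling of a valuation.\<close>

definition ground_inst :: "(var \<Rightarrow> 'c) \<Rightarrow> ('p, 'c) atom \<Rightarrow> ('p, 'c) atom" where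
  "ground_inst \<kappa> = subst_atom (\<lambda>v. Const (\<kappa> v))"

lemma subst_atom_cong:
  "(\<And>v. v \<in> avars a \<Longrightarrow> \<sigma> v = \<tau> v) \<Longrightarrow> subst_atom \<sigma> a = subst_atom \<tau> a"
proof -
  assume *: "\<And>v. v \<in> avars a \<Longrightarrow> \<sigma> v = \<tau> v"
  have "subst_trm \<sigma> t = subst_trm \<tau> t" if "t \<in> set (aargs a)" for t
  proof -
    have "\<sigma> v = \<tau> v" if "v \<in> tvars t" for v
      using that \<open>t \<in> set (aargs a)\<close> by (intro *) (auto simp: avars_def)
    then show ?thesis by (cases t) auto
  qed
  then show ?thesis by (simp add: subst_atom_def)
qed

lemma subst_atom_eqD:
  assumes "subst_atom \<sigma> a = subst_atom \<tau> a" "v \<in> avars a"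
  shows "\<sigma> v = \<tau> v"
proof -
  obtain t where t: "t \<in> set (aargs a)" "v \<in> tvars t"
    using assms(2) by (auto simp: avars_def)
  then have "subst_trm \<sigma> t = subst_trm \<tau> t"
    using assms(1) by (simp add: subst_atom_def)
  then show ?thesis using t(2) by (cases t) auto
qed

lemma subst_ground_inst: "subst_atom \<sigma> (ground_inst \<kappa> a) = ground_inst \<kappa> a"
proof -
  have "subst_trm \<sigma> (subst_trm (\<lambda>v. Const (\<kappa> v)) t) = subst_trm (\<lambda>v. Const (\<kappa> v)) t" for t
    by (cases t) auto
  then show ?thesis by (simp add: ground_inst_def subst_atom_def)
qed

lemma avars_ground_inst: "avars (ground_inst \<kappa> a) = {}"
proof -
  have "tvars (subst_trm (\<lambda>v. Const (\<kappa> v)) t) = {}" for t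
    by (cases t) auto
  then show ?thesis by (simp add: ground_inst_def subst_atom_def avars_def)
qed

lemma is_fact_ground_inst: "wf_atom a \<Longrightarrow> is_fact (ground_inst \<kappa> a)"
  by (simp add: is_fact_def avars_ground_inst)
    (simp add: wf_atom_def ground_inst_def subst_atom_def)

text \<open>The unifier binds exactly the body variables, to their values under
  \<open>\<kappa>\<close>, and leaves all others alone. Any unifier \<open>\<tau>\<close> has these
  same bindings on the body, so it factors through \<open>\<sigma>\<close> with
  \<open>\<tau>\<close> itself as second factor. The second assumption is safety; it makes the head
  ground under \<open>\<sigma>\<close>.\<close>

lemma consequence_ground_inst:
  assumes "wf_atom (dlhead r)" and "avars (dlhead r) \<subseteq> (\<Union>a\<in>set (dlbody r). avars a)"
  shows "consequence r (map (ground_inst \<kappa>) (dlbody r)) (ground_inst \<kappa> (dlhead r))"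
proof -
  let ?V = "\<Union>a\<in>set (dlbody r). avars a"
  let ?facts = "map (ground_inst \<kappa>) (dlbody r)"
  define \<sigma> :: "var \<Rightarrow> 'b trm" where "\<sigma> v = (if v \<in> ?V then Const (\<kappa> v) else Var v)" for v
  have \<sigma>: "subst_atom \<sigma> a = ground_inst \<kappa> a" if "avars a \<subseteq> ?V" for a :: "('a, 'b) atom"
    unfolding ground_inst_def using that by (intro subst_atom_cong) (auto simp: \<sigma>_def)
  have u: "unifies \<sigma> ?facts (dlbody r)"
    unfolding unifies_def by (auto simp: subst_ground_inst intro!: \<sigma>[symmetric])
  have m: "\<tau> v = subst_trm \<tau> (\<sigma> v)" if "unifies \<tau> ?facts (dlbody r)" for \<tau> v
  proof (cases "v \<in> ?V")
    case True
    then obtain a where a: "a \<in> set (dlbody r)" "v \<in> avars a" by blast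
    have "subst_atom \<tau> a = subst_atom (\<lambda>v. Const (\<kappa> v)) a"
      using that a(1) by (auto simp: unifies_def subst_ground_inst)
        (simp add: ground_inst_def)
    from subst_atom_eqD[OF this a(2)] show ?thesis using True by (simp add: \<sigma>_def)
  qed (simp add: \<sigma>_def)
  have "is_mgu \<sigma> ?facts (dlbody r)"
    unfolding is_mgu_def using u m by blast
  then show ?thesis
    unfolding consequence_def using assms \<sigma>[of "dlhead r"] is_fact_ground_inst by metis
qed

section \<open>Composition of proofs and growth of support\<close>

text \<open>Subproofs are given by a function on facts, so that the proof of one premise can later
  be exchanged by a function update.\<close>

lemma proof_of_step:
  assumes "r \<in> P" "consequence r fs \<gamma>" "\<And>f. f \<in> set fs \<Longrightarrow> proof_of P A f (tr f)"
  shows "proof_of P A \<gamma> (Step \<gamma> r (map tr fs))"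
proof -
  have "map root (map tr fs) = fs"
    using assms(3) by (auto simp: proof_of_def intro: map_idI)
  then show ?thesis using assms by (auto simp: proof_of_def simp del: map_map)
qed

lemma derivable_step:
  assumes "r \<in> P" "consequence r fs \<gamma>" "\<And>f. f \<in> set fs \<Longrightarrow> derivable P A f"
  shows "derivable P A \<gamma>" and "r \<in> fact_support P A \<gamma>"
proof -
  obtain tr where "\<And>f. f \<in> set fs \<Longrightarrow> proof_of P A f (tr f)"
    using assms(3) unfolding derivable_def by metis
  from proof_of_step[OF assms(1,2) this]
  have p: "proof_of P A \<gamma> (Step \<gamma> r (map tr fs))" .
  then show "derivable P A \<gamma>" unfolding derivable_def by blast
  show "r \<in> fact_support P A \<gamma>" unfolding fact_support_def using p by fastforce
qed

text \<open>Any proof of \<open>f\<close> can be grafted under the final step, the other premises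
  having proofs as well; its rules then occur in a proof of \<open>\<gamma>\<close>.\<close>

lemma fact_support_premise:
  assumes "r \<in> P" "consequence r fs \<gamma>" "\<And>f. f \<in> set fs \<Longrightarrow> derivable P A f" "f \<in> set fs"
  shows "fact_support P A f \<subseteq> fact_support P A \<gamma>"
proof
  fix s assume "s \<in> fact_support P A f"
  then obtain t where t: "proof_of P A f t" "s \<in> tree_rules t"
    by (auto simp: fact_support_def)
  obtain tr where tr: "\<And>f. f \<in> set fs \<Longrightarrow> proof_of P A f (tr f)"
    using assms(3) unfolding derivable_def by metis
  have "proof_of P A \<gamma> (Step \<gamma> r (map (tr(f := t)) fs))"
    using t(1) tr by (intro proof_of_step[OF assms(1,2)]) auto
  moreover have "s \<in> tree_rules (Step \<gamma> r (map (tr(f := t)) fs))"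
    using t(2) assms(4) by auto
  ultimately show "s \<in> fact_support P A \<gamma>" unfolding fact_support_def by blast
qed

section \<open>Ground instances of corresponding datalog rules\<close>

lemma ground_inst_ex_subst:
  assumes "\<And>v. v \<in> set (exvars r) \<Longrightarrow> \<kappa> v = \<theta> v"
  shows "ground_inst \<kappa> (subst_atom (ex_subst \<theta> r) a) = ground_inst \<kappa> a"
proof -
  have "subst_trm (\<lambda>v. Const (\<kappa> v)) (subst_trm (ex_subst \<theta> r) t) = subst_trm (\<lambda>v. Const (\<kappa> v)) t"
    for t using assms by (cases t) (auto simp: ex_subst_def)
  then show ?thesis by (simp add: ground_inst_def subst_atom_def)
qed

lemma avars_ex_subst: "avars (subst_atom (ex_subst \<theta> r) a) = avars a - set (exvars r)"
proof -
  have "tvars (subst_trm (ex_subst \<theta> r) t) = tvars t - set (exvars r)" for t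
    by (cases t) (auto simp: ex_subst_def)
  then show ?thesis by (auto simp: avars_def subst_atom_def)
qed

text \<open>Since \<open>\<kappa>\<close> sends existential variables to the constants of
  \<open>\<theta>\<close>, applying \<open>\<theta>\<close> to the head first changes nothing; by
  safety, the variables that remain occur in the body.\<close>

lemma consequence_corresponding:
  assumes "wf_rule r" "a \<in> head_atoms r" "\<And>v. v \<in> set (exvars r) \<Longrightarrow> \<kappa> v = \<theta> v"
  shows "consequence (DL (body r) (subst_atom (ex_subst \<theta> r) a))
           (map (ground_inst \<kappa>) (body r)) (ground_inst \<kappa> a)"
proof -
  let ?h = "subst_atom (ex_subst \<theta> r) a"
  have "wf_atom ?h"
    using assms(1,2) by (auto simp: wf_rule_def rule_atoms_def wf_atom_def subst_atom_def)
  moreover have "avars ?h \<subseteq> (\<Union>b\<in>set (body r). avars b)"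
    using assms(1,2) unfolding avars_ex_subst wf_rule_def safe_def body_vars_def by blast
  ultimately show ?thesis
    using consequence_ground_inst[of "DL (body r) ?h" \<kappa>]
      ground_inst_ex_subst[of r \<kappa> \<theta> a, OF assms(3)] by simp
qed

section \<open>Labelled copies of elements\<close>

text \<open>An infinite type has the cardinality of its product with a finite nonempty
  \<open>K\<close>; \<open>p\<close> and \<open>l\<close> are the components of a bijection. Thus
  all labelled copies fit into \<open>'d\<close> itself, the type to which entailment is
  tied.\<close>

lemma infinite_labelling:
  includes cardinal_syntax
  fixes K :: "'c set"
  assumes "finite K" "K \<noteq> {}"
  shows "\<exists>(p :: 'd::infinite \<Rightarrow> 'd) l. (\<forall>d. l d \<in> K) \<and> (\<forall>u. \<forall>k\<in>K. \<exists>d. p d = u \<and> l d = k)"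
proof -
  have inf: "infinite (UNIV :: 'd set)" by (rule infinite_UNIV)
  have "|K| <o |UNIV :: 'd set|"
    using assms(1) inf
    by (intro finite_ordLess_infinite card_of_Well_order) (simp_all add: Field_card_of)
  then have "|UNIV :: 'd set| =o |(UNIV :: 'd set) \<times> K|"
    by (intro card_of_Times_infinite_simps(2) inf assms(2) ordLess_imp_ordLeq)
  then obtain f where f: "bij_betw f (UNIV :: 'd set) ((UNIV :: 'd set) \<times> K)"
    using card_of_ordIso by blast
  have "snd (f d) \<in> K" for d
    using bij_betwE[OF f] by (simp add: mem_Times_iff)
  moreover have "\<exists>d. fst (f d) = u \<and> snd (f d) = k" if "k \<in> K" for u k
  proof -
    have "(u, k) \<in> f ` UNIV" using bij_betw_imp_surj_on[OF f] that by simp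
    then show ?thesis by (metis fst_conv imageE snd_conv)
  qed
  ultimately show ?thesis
    by (intro exI[of _ "\<lambda>d. fst (f d)"] exI[of _ "\<lambda>d. snd (f d)"]) blast
qed

section \<open>Lifting countermodels from the module to the TBox\<close>

lemma entails_mono: "entails D M A q \<Longrightarrow> M \<subseteq> T \<Longrightarrow> entails D T A q"
  unfolding entails_def by blast

lemma countermodel_lift:
  fixes T :: "('p, 'c) rule set" and \<Sigma> :: "'p pred set" and I :: "('p, 'c, 'd::infinite) interp"
    and c :: "var \<Rightarrow> 'c" and star :: 'c
  defines "\<chi> \<equiv> chi_q T \<Sigma> c star"
  assumes T: "tbox T" "tbox_consts T = {}" and \<Sigma>: "Falsum \<in> \<Sigma>"
    and I: "interpretation_on I" "\<And>r. r \<in> module_of T \<chi> \<Longrightarrow> sat_rule I r"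
    and A: "\<And>a. a \<in> A \<Longrightarrow> is_fact a \<and> apred a \<in> \<Sigma> \<and> sat_fact I a"
    and q: "query_over \<Sigma> q" "\<not> sat_query I q"
  obtains J :: "('p, 'c, 'd) interp"
  where "interpretation_on J" "\<And>r. r \<in> T \<Longrightarrow> sat_rule J r" "\<And>a. a \<in> A \<Longrightarrow> sat_fact J a"
    "\<not> sat_query J q"
proof -
  define K where "K = insert star (c ` tbox_exvars T)"
  have "finite K" "K \<noteq> {}"
    using T(1) by (auto simp: K_def tbox_def tbox_exvars_def)
  obtain p :: "'d \<Rightarrow> 'd" and l :: "'d \<Rightarrow> 'c"
    where pl': "(\<forall>d. l d \<in> K) \<and> (\<forall>u. \<forall>k\<in>K. \<exists>d. p d = u \<and> l d = k)"
    using infinite_labelling[OF \<open>finite K\<close> \<open>K \<noteq> {}\<close>, where 'd = 'd] by (elim exE)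
  from pl' have l: "\<And>d. l d \<in> K" by simp
  from pl' have "\<forall>u k. \<exists>d. k \<in> K \<longrightarrow> p d = u \<and> l d = k" by blast
  then obtain copy where copy: "\<And>u k. k \<in> K \<Longrightarrow> p (copy u k) = u \<and> l (copy u k) = k"
    by metis
  have starK: "star \<in> K" by (simp add: K_def)
  note copy_star = copy[OF starK, THEN conjunct1] copy[OF starK, THEN conjunct2]

  define der where "der = derivable (program T \<chi>) (facts0 \<chi>)"
  \<comment> \<open>A fact without a proof has empty support and counts as relevant;
    \<open>J\<close> demands \<open>der\<close> separately, so this is harmless.\<close>
  define rel where "rel f \<longleftrightarrow> fact_support (program T \<chi>) (facts0 \<chi>) f \<subseteq> setting_support T \<chi>" for f
  define lab where "lab P ds = Atom P (map (\<lambda>d. Const (l d)) ds)" for P :: "'p pred" and ds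
  define U where "U = {d. p d \<in> universe I}"
  define J :: "('p, 'c, 'd) interp" where
    "J = \<lparr> universe = U, const_of = (\<lambda>a. copy (const_of I a) star),
           rel_of = (\<lambda>P. {ds. length ds = arity P \<and> set ds \<subseteq> U \<and> der (lab P ds) \<and>
                            (rel (lab P ds) \<longrightarrow> map p ds \<in> rel_of I P)}) \<rparr>"

  have I': "universe I \<noteq> {}" "\<And>a. const_of I a \<in> universe I" "rel_of I Falsum = {}"
    using I(1) by (auto simp: interpretation_on_def)
  have eval_U: "eval J \<nu> t \<in> U" if "valuation J \<nu>" for \<nu> t
    using that I'(2) by (cases t) (auto simp: J_def valuation_def U_def copy_star)
  have p_eval: "p (eval J \<nu> t) = eval I (p \<circ> \<nu>) t" for \<nu> t
    by (cases t) (simp_all add: J_def copy_star)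
  have map_p_eval: "map p (map (eval J \<nu>) ts) = map (eval I (p \<circ> \<nu>)) ts" for \<nu> ts
    by (simp add: p_eval)
  \<comment> \<open>Labels lie in \<open>K\<close>, and \<open>factsr\<close> contains every
    \<Sigma>-fact over \<open>K\<close>, so whatever supports such a fact supports
    \<open>\<chi>\<close>.\<close>
  have rel_\<Sigma>: "rel (lab P ds)" if "P \<in> \<Sigma>" "length ds = arity P" for P ds
  proof -
    have "lab P ds = Atom P (map Const (map l ds))" "length (map l ds) = arity P"
      "set (map l ds) \<subseteq> K"
      using l that(2) by (auto simp: lab_def)
    then have "lab P ds \<in> factsr \<chi>"
      using that(1) unfolding \<chi>_def chi_q_def K_def setting.simps by blast
    then show ?thesis by (auto simp: rel_def setting_support_def)
  qed

  have sat_J: "sat_atom J \<nu> a \<longleftrightarrow> der (ground_inst (l \<circ> \<nu>) a) \<and>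
      (rel (ground_inst (l \<circ> \<nu>) a) \<longrightarrow> sat_atom I (p \<circ> \<nu>) a)"
    if "valuation J \<nu>" "r \<in> T" "a \<in> rule_atoms r" for \<nu> r a
  proof -
    \<comment> \<open>Here \<open>T\<close> must be free of constants: a constant evaluates to a
      copy labelled \<open>star\<close>, whereas a ground instance would keep the constant.\<close>
    have "tconsts t = {}" if "t \<in> set (aargs a)" for t
      using T(2) \<open>r \<in> T\<close> \<open>a \<in> rule_atoms r\<close> that by (fastforce simp: tbox_consts_def aconsts_def)
    then have "Const (l (eval J \<nu> t)) = subst_trm (\<lambda>v. Const ((l \<circ> \<nu>) v)) t"
      if "t \<in> set (aargs a)" for t
      using that by (cases t) fastforce+
    then have "lab (apred a) (map (eval J \<nu>) (aargs a)) = ground_inst (l \<circ> \<nu>) a"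
      by (simp add: lab_def ground_inst_def subst_atom_def)
    moreover have "length (aargs a) = arity (apred a)"
      using T(1) that by (auto simp: tbox_def wf_rule_def wf_atom_def)
    moreover have "set (map (eval J \<nu>) (aargs a)) \<subseteq> U" using eval_U that(1) by auto
    ultimately show ?thesis
      unfolding sat_atom_def by (simp add: J_def p_eval[unfolded J_def] comp_def)
  qed

  show ?thesis
  proof (rule that)
    obtain u where u: "u \<in> universe I" using I'(1) by blast
    have "copy u star \<in> U" using u by (simp add: U_def copy_star)
    \<comment> \<open>Falsehood may be derivable, but being a \<Sigma>-fact it is relevant, so it
      would also have to hold in \<open>I\<close>.\<close>
    moreover have "[] \<notin> rel_of J Falsum"
      using rel_\<Sigma>[OF \<Sigma>, of "[]"] I'(3) by (simp add: J_def)
    then have "rel_of J Falsum = {}" by (auto simp: J_def)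
    moreover have "copy (const_of I a) star \<in> U" for a
      using I'(2) by (simp add: U_def copy_star)
    ultimately show "interpretation_on J"
      unfolding interpretation_on_def by (auto simp: J_def)
  next
    fix a assume a: "a \<in> A"
    show "sat_fact J a"
      unfolding sat_fact_def
    proof (intro allI impI)
      fix \<nu> assume \<nu>: "valuation J \<nu>"
      have a': "wf_atom a" "avars a = {}" "apred a \<in> \<Sigma>" "sat_fact I a"
        using A[OF a] by (auto simp: is_fact_def)
      have len: "length (aargs a) = arity (apred a)" using a'(1) by (simp add: wf_atom_def)
      have "valuation I (p \<circ> \<nu>)" using \<nu> by (auto simp: valuation_def J_def U_def)
      then have I_a: "sat_atom I (p \<circ> \<nu>) a" using a'(4) by (simp add: sat_fact_def)
      have "tvars t = {}" if "t \<in> set (aargs a)" for t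
        using a'(2) that by (auto simp: avars_def)
      \<comment> \<open>The arguments are constants, so the labels form precisely a fact of
        \<open>facts0\<close>, which a leaf proves.\<close>
      then have "l (eval J \<nu> t) = star" if "t \<in> set (aargs a)" for t
        using that by (cases t) (fastforce simp: J_def copy_star)+
      then have "lab (apred a) (map (eval J \<nu>) (aargs a))
          = Atom (apred a) (replicate (arity (apred a)) (Const star))"
        using len by (auto simp: lab_def intro!: replicate_eqI)
      then have "lab (apred a) (map (eval J \<nu>) (aargs a)) \<in> facts0 \<chi>"
        using a'(3) by (auto simp: \<chi>_def chi_q_def)
      then have "proof_of (program T \<chi>) (facts0 \<chi>) (lab (apred a) (map (eval J \<nu>) (aargs a)))
          (Leaf (lab (apred a) (map (eval J \<nu>) (aargs a))))"
        by (simp add: proof_of_def)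
      then have d: "der (lab (apred a) (map (eval J \<nu>) (aargs a)))"
        unfolding der_def derivable_def by blast
      have "set (map (eval J \<nu>) (aargs a)) \<subseteq> U" using eval_U[OF \<nu>] by auto
      then show "sat_atom J \<nu> a"
        using I_a d len unfolding sat_atom_def map_p_eval[symmetric] by (simp add: J_def)
    qed
  next
    show "\<not> sat_query J q"
    proof
      assume J: "sat_query J q"
      have "sat_query I q"
        unfolding sat_query_def
      proof (intro allI impI)
        fix \<nu> assume \<nu>: "valuation I \<nu>"
        \<comment> \<open>Any copies of the values of \<open>\<nu>\<close> project back to
          \<open>\<nu>\<close>; \<open>star\<close> is merely a label known to lie in
          \<open>K\<close>.\<close>
        have "valuation J (\<lambda>v. copy (\<nu> v) star)"
          using \<nu> by (auto simp: valuation_def J_def U_def copy_star)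
        then obtain \<mu> where \<mu>: "valuation J \<mu>" "variant_on (qvars q) (\<lambda>v. copy (\<nu> v) star) \<mu>"
            "sat_matrix J \<mu> (qmatrix q)"
          using J unfolding sat_query_def by blast
        have "sat_atom I (p \<circ> \<mu>) a" if "sat_atom J \<mu> a" "wf_atom a" "apred a \<in> \<Sigma>" for a
          using that rel_\<Sigma>[of "apred a" "map (eval J \<mu>) (aargs a)"]
          unfolding sat_atom_def map_p_eval[symmetric] by (simp add: J_def wf_atom_def)
        then have "sat_matrix I (p \<circ> \<mu>) m" if "sat_matrix J \<mu> m"
          "\<forall>a\<in>matrix_atoms m. wf_atom a \<and> apred a \<in> \<Sigma>" for m
          using that by (induction m) auto
        then have "sat_matrix I (p \<circ> \<mu>) (qmatrix q)" using \<mu>(3) q(1) by (auto simp: query_over_def)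
        moreover have "valuation I (p \<circ> \<mu>)" using \<mu>(1) by (auto simp: valuation_def J_def U_def)
        moreover have "variant_on (qvars q) \<nu> (p \<circ> \<mu>)"
          using \<mu>(2) by (simp add: variant_on_def copy_star)
        ultimately show "\<exists>\<mu>. valuation I \<mu> \<and> variant_on (qvars q) \<nu> \<mu> \<and> sat_matrix I \<mu> (qmatrix q)"
          by blast
      qed
      with q(2) show False ..
    qed
  next
    fix r assume r: "r \<in> T"
    have wf: "wf_rule r" using T(1) r by (simp add: tbox_def)
    show "sat_rule J r"
      unfolding sat_rule_def
    proof (intro allI impI)
      fix \<nu> assume \<nu>: "valuation J \<nu>" and b: "\<forall>a\<in>set (body r). sat_atom J \<nu> a"
      \<comment> \<open>These are the labels of the valuation to be built: existential variables get
        their constants, all others the label of their present value.\<close>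
      define \<kappa> where "\<kappa> v = (if v \<in> set (exvars r) then c v else l (\<nu> v))" for v
      have \<kappa>_body: "ground_inst \<kappa> a = ground_inst (l \<circ> \<nu>) a" if "a \<in> set (body r)" for a
        unfolding ground_inst_def using that wf
        by (intro subst_atom_cong) (auto simp: \<kappa>_def wf_rule_def body_vars_def)
      have body_J: "der (ground_inst \<kappa> a)" "rel (ground_inst \<kappa> a) \<Longrightarrow> sat_atom I (p \<circ> \<nu>) a"
        if "a \<in> set (body r)" for a
        using b that sat_J[OF \<nu> r, of a] by (auto simp: \<kappa>_body rule_atoms_def)
      define rl where "rl a = DL (body r) (subst_atom (ex_subst c r) a)" for a
      have thc: "theta \<chi> = c" by (simp add: \<chi>_def chi_q_def)
      have rl: "rl a \<in> corresponding (theta \<chi>) r" if "a \<in> head_atoms r" for a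
        using that by (auto simp: corresponding_def rl_def thc head_atoms_def)
      \<comment> \<open>A datalog rule of \<open>r\<close> that derives a relevant fact lies in the
        support of \<open>\<chi>\<close>, so \<open>r\<close> is in the module. The premises have
        smaller support, hence are relevant too, and the body of \<open>r\<close> holds in
        \<open>I\<close>.\<close>
      have module: "\<exists>\<mu>. valuation I \<mu> \<and> variant_on (exvars r) (p \<circ> \<nu>) \<mu> \<and>
          (\<exists>\<psi>\<in>set (heads r). \<forall>a\<in>set \<psi>. sat_atom I \<mu> a)"
        if s: "s \<in> corresponding (theta \<chi>) r"
          and cs: "consequence s (map (ground_inst \<kappa>) (body r)) h" and h: "rel h" for s h
      proof -
        have sP: "s \<in> program T \<chi>" using s r by (auto simp: program_def)
        have ders: "\<And>f. f \<in> set (map (ground_inst \<kappa>) (body r)) \<Longrightarrow>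
            derivable (program T \<chi>) (facts0 \<chi>) f"
          using body_J(1) by (auto simp: der_def)
        have "s \<in> setting_support T \<chi>"
          using derivable_step(2)[OF sP cs ders] h by (auto simp: rel_def)
        then have "r \<in> module_of T \<chi>" using s r by (auto simp: module_of_def)
        then have "sat_rule I r" by (rule I(2))
        moreover have "sat_atom I (p \<circ> \<nu>) a" if "a \<in> set (body r)" for a
        proof (rule body_J(2)[OF that])
          show "rel (ground_inst \<kappa> a)"
            using fact_support_premise[OF sP cs ders, of "ground_inst \<kappa> a"] h that
            by (auto simp: rel_def)
        qed
        moreover have "valuation I (p \<circ> \<nu>)" using \<nu> by (auto simp: valuation_def J_def U_def)
        ultimately show ?thesis unfolding sat_rule_def by blast
      qed
      have cons: "consequence (rl a) (map (ground_inst \<kappa>) (body r)) (ground_inst \<kappa> a)"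
        if "a \<in> head_atoms r" for a
        unfolding rl_def by (rule consequence_corresponding[OF wf that]) (simp add: \<kappa>_def)
      \<comment> \<open>The program has a rule for every atom of every disjunct, so all head atoms
        are derivable, whichever disjunct is picked below.\<close>
      have der_head: "der (ground_inst \<kappa> a)" if "a \<in> head_atoms r" for a
        unfolding der_def
        using derivable_step(1)[OF _ cons[OF that], of "program T \<chi>" "facts0 \<chi>"]
          rl[OF that] r body_J(1) by (auto simp: program_def der_def)
      \<comment> \<open>Only relevant atoms constrain the choice of a disjunct. If there is one in
        any disjunct, \<open>I\<close> satisfies \<open>r\<close> and makes the choice; if there is
        none, every disjunct will do.\<close>
      have "\<exists>\<mu>. valuation I \<mu> \<and> variant_on (exvars r) (p \<circ> \<nu>) \<mu> \<and>
          (\<exists>\<psi>\<in>set (heads r). \<forall>a\<in>set \<psi>. rel (ground_inst \<kappa> a) \<longrightarrow> sat_atom I \<mu> a)"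
      proof (cases "\<exists>a\<in>head_atoms r. rel (ground_inst \<kappa> a)")
        case True
        then show ?thesis using module rl cons by blast
      next
        case False
        \<comment> \<open>An empty head would derive falsehood, a relevant fact; then
          \<open>r\<close> would be in the module and \<open>I\<close> would satisfy a member of an
          empty list of disjuncts.\<close>
        have "heads r \<noteq> []"
        proof
          assume e: "heads r = []"
          have "consequence (DL (body r) bot_atom) (map (ground_inst \<kappa>) (body r))
              (ground_inst \<kappa> bot_atom)"
            using consequence_ground_inst[of "DL (body r) bot_atom" \<kappa>]
            by (simp add: wf_atom_def avars_def)
          moreover have "rel (ground_inst \<kappa> bot_atom)"
            using rel_\<Sigma>[OF \<Sigma>, of "[]"] by (simp add: lab_def ground_inst_def subst_atom_def)
          ultimately show False
            using module[of "DL (body r) bot_atom"] e by (auto simp: corresponding_def)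
        qed
        then have "hd (heads r) \<in> set (heads r)" by simp
        moreover have "valuation I (p \<circ> \<nu>)" using \<nu> by (auto simp: valuation_def J_def U_def)
        ultimately show ?thesis
          using False unfolding head_atoms_def variant_on_def by blast
      qed
      then obtain \<mu> \<psi> where \<mu>: "valuation I \<mu>" "variant_on (exvars r) (p \<circ> \<nu>) \<mu>"
        "\<psi> \<in> set (heads r)" "\<And>a. a \<in> set \<psi> \<Longrightarrow> rel (ground_inst \<kappa> a) \<Longrightarrow> sat_atom I \<mu> a" by blast
      \<comment> \<open>Each existential value is replaced by its copy labelled with the constant of
        its variable, so that projecting yields \<open>\<mu>\<close> and reading off labels yields
        \<open>\<kappa>\<close>.\<close>
      define \<mu>' where "\<mu>' v = (if v \<in> set (exvars r) then copy (\<mu> v) (c v) else \<nu> v)" for v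
      have cK: "c v \<in> K" if "v \<in> set (exvars r)" for v
        using r that by (auto simp: K_def tbox_exvars_def)
      have p\<mu>': "p \<circ> \<mu>' = \<mu>"
        using \<mu>(2) copy cK by (auto simp: fun_eq_iff \<mu>'_def variant_on_def)
      have l\<mu>': "l \<circ> \<mu>' = \<kappa>"
        using copy cK by (auto simp: fun_eq_iff \<mu>'_def \<kappa>_def)
      have "p (\<mu>' v) \<in> universe I" for v
        using \<mu>(1) p\<mu>' by (auto simp: valuation_def)
      then have v': "valuation J \<mu>'" by (auto simp: valuation_def J_def U_def)
      moreover have "variant_on (exvars r) \<nu> \<mu>'" by (simp add: variant_on_def \<mu>'_def)
      moreover have "sat_atom J \<mu>' a" if "a \<in> set \<psi>" for a
      proof -
        have h: "a \<in> head_atoms r" using that \<mu>(3) by (auto simp: head_atoms_def)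
        then show ?thesis
          using sat_J[OF v' r, of a] der_head[OF h] \<mu>(4)[OF that] p\<mu>' l\<mu>'
          by (simp add: rule_atoms_def)
      qed
      ultimately show "\<exists>\<mu>. valuation J \<mu> \<and> variant_on (exvars r) \<nu> \<mu> \<and>
          (\<exists>\<psi>\<in>set (heads r). \<forall>a\<in>set \<psi>. sat_atom J \<mu> a)"
        using \<mu>(3) by blast
    qed
  qed
qed

section \<open>Query inseparability of the module\<close>

theorem theorem7:
  fixes T :: "('p, 'c) rule set"
    and \<Sigma> :: "'p pred set"
    and c :: "var \<Rightarrow> 'c"
    and star :: 'c
  assumes "tbox T"
    and "tbox_consts T = {}"
    and "disjoint_exvars T"
    and "signature \<Sigma>"
    and "\<Sigma> \<subseteq> sig T"
    and "fresh_constants T c star"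
  shows "query_inseparable TYPE('d::infinite) \<Sigma> (module_of T (chi_q T \<Sigma> c star)) T"
proof -
  let ?M = "module_of T (chi_q T \<Sigma> c star)"
  \<comment> \<open>Only this direction needs the construction; the converse is monotonicity, the
    module being a subset of \<open>T\<close>.\<close>
  have "entails TYPE('d) ?M A q"
    if q: "query_over \<Sigma> q" and A: "abox \<Sigma> A" and e: "entails TYPE('d) T A q" for q A
  proof (rule ccontr)
    assume "\<not> entails TYPE('d) ?M A q"
    then obtain I :: "('p, 'c, 'd) interp" where I: "interpretation_on I"
      "\<And>r. r \<in> ?M \<Longrightarrow> sat_rule I r" "\<And>a. a \<in> A \<Longrightarrow> sat_fact I a" "\<not> sat_query I q"
      unfolding entails_def by blast
    have "Falsum \<in> \<Sigma>" using assms(4) by (simp add: signature_def)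
    moreover have "is_fact a \<and> apred a \<in> \<Sigma> \<and> sat_fact I a" if "a \<in> A" for a
      using A I(3) that by (auto simp: abox_def)
    ultimately obtain J :: "('p, 'c, 'd) interp" where "interpretation_on J"
      "\<And>r. r \<in> T \<Longrightarrow> sat_rule J r" "\<And>a. a \<in> A \<Longrightarrow> sat_fact J a" "\<not> sat_query J q"
      using countermodel_lift[OF assms(1,2) _ I(1,2) _ q I(4)] by metis
    with e show False unfolding entails_def by blast
  qed
  moreover have "?M \<subseteq> T" by (auto simp: module_of_def)
  ultimately show ?thesis
    unfolding query_inseparable_def using entails_mono by blast
qed

end
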